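(* Let $(M,\|\cdot\|)$ be a Minkowski plane and let $x_1,x_2,x_3,p_4\in M$. Let $m_1,m_2,m_3$ be the midpoints of the segments $[x_2,x_3]$, $[x_1,x_3]$, $[x_1,x_2]$ respectively, and define $p_i=S_{m_i}(p_4)$ for $i=1,2,3$. Then: 1. The segments $[x_i,p_i]$, $i=1,2,3$, all have the same midpoint $q$, namely $q=\frac{x_1+x_2+x_3-p_4}{2}$; moreover $2(q-m_i)=x_i-p_4$ for $i=1,2,3$. 2. If $x_4=S_q(p_4)$, then $x_i-x_j=p_j-p_i$ for all $\{i,j\}\subset\{1,2,3,4\}$. 3. With $x_4=S_q(p_4)$, one has $x_i-p_j=p_k-x_l$ whenever $\{i,j,k,l\}=\{1,2,3,4\}$. 4. If $g=\frac{x_1+x_2+x_3}{3}$, then $H_{g,-2}(p_4)=x_4$, where $x_4=S_q(p_4)$.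
   Context: A Minkowski plane is a real two-dimensional normed linear space. For $p\in M$, $S_p$ denotes the point symmetry $S_p(w)=2p-w$, and $H_{p,-2}$ denotes the homothety with center $p$ and ratio $-2$, $H_{p,-2}(w)=3p-2w$. $[x,y]$ is the segment between $x$ and $y$. *)

theory Defs
  imports "HOL-Analysis.Analysis"
begin

definition point_symmetry :: "'a::real_vector \<Rightarrow> 'a \<Rightarrow> 'a" where
  "point_symmetry c w = 2 *\<^sub>R c - w"

definition homothety :: "'a::real_vector \<Rightarrow> real \<Rightarrow> 'a \<Rightarrow> 'a" where
  "homothety c r w = c + r *\<^sub>R (w - c)"

lemma homothety_minus_two: "homothety c (-2) w = 3 *\<^sub>R c - 2 *\<^sub>R w"
proof -
  have "3 *\<^sub>R c = c + 2 *\<^sub>R c"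
    using scaleR_left_distrib[of 1 2 c] by simp
  then show ?thesis
    by (simp add: homothety_def algebra_simps)
qed

end

theory Submission
  imports Defs
begin

text \<open>
  Put \<open>s = x\<^sub>1 + x\<^sub>2 + x\<^sub>3 - p\<^sub>4\<close>. With \<open>x\<^sub>4 = s - p\<^sub>4\<close> one has \<open>p\<^sub>i = s - x\<^sub>i\<close> for every \<open>i\<close>, and
  \<open>x\<^sub>1 + x\<^sub>2 + x\<^sub>3 + x\<^sub>4 = 2s\<close>; all four claims are linear consequences of these two identities.
\<close>

theorem theorem3p1:
  fixes x p m :: "nat \<Rightarrow> 'a::real_normed_vector"
  assumes plane: "dim (UNIV :: 'a set) = 2"
    and m1: "m 1 = midpoint (x 2) (x 3)"
    and m2: "m 2 = midpoint (x 1) (x 3)"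
    and m3: "m 3 = midpoint (x 1) (x 2)"
    and p: "\<forall>i\<in>{1, 2, 3}. p i = point_symmetry (m i) (p 4)"
  shows "\<exists>q.
      ((\<forall>i\<in>{1, 2, 3}. midpoint (x i) (p i) = q)
        \<and> q = (x 1 + x 2 + x 3 - p 4) /\<^sub>R 2
        \<and> (\<forall>i\<in>{1, 2, 3}. 2 *\<^sub>R (q - m i) = x i - p 4))
    \<and> (x 4 = point_symmetry q (p 4) \<longrightarrow>
        (\<forall>i j. {i, j} \<subseteq> {1, 2, 3, 4} \<longrightarrow> x i - x j = p j - p i))
    \<and> (x 4 = point_symmetry q (p 4) \<longrightarrow>
        (\<forall>i j k l. {i, j, k, l} = {1, 2, 3, 4} \<longrightarrow> x i - p j = p k - x l))
    \<and> (\<forall>g. g = (x 1 + x 2 + x 3) /\<^sub>R 3 \<longrightarrow> x 4 = point_symmetry q (p 4) \<longrightarrow>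
        homothety g (-2) (p 4) = x 4)"
proof -
  \<comment> \<open>Keeps the index \<open>1\<close> from becoming \<open>Suc 0\<close>, so that
    equations about \<open>x 1\<close> and \<open>m 1\<close> still match.\<close>
  note One_nat_def [simp del]
  define s where "s = x 1 + x 2 + x 3 - p 4"
  define q where "q = s /\<^sub>R 2"
  have two_q: "2 *\<^sub>R q = s"
    by (simp add: q_def)
  have two_m: "2 *\<^sub>R m 1 = x 2 + x 3" "2 *\<^sub>R m 2 = x 1 + x 3" "2 *\<^sub>R m 3 = x 1 + x 2"
    unfolding m1 m2 m3 by (simp_all add: midpoint_def)
  \<comment> \<open>Twice \<open>m i\<close> is the sum of the two vertices other than
    \<open>x i\<close>, that is, \<open>s + p 4 - x i\<close>.\<close>
  have p_eq: "p i = s - x i" if "i \<in> {1, 2, 3}" for i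
    using that p two_m by (auto simp: point_symmetry_def s_def)
  have mid: "\<forall>i\<in>{1, 2, 3}. midpoint (x i) (p i) = q"
    by (simp add: p_eq midpoint_def q_def)
  have diff: "\<forall>i\<in>{1, 2, 3}. 2 *\<^sub>R (q - m i) = x i - p 4"
    by (auto simp: scaleR_diff_right two_q two_m s_def)
  \<comment> \<open>The new case \<open>i = 4\<close> is the reflection \<open>x 4 = s - p 4\<close>
    rearranged.\<close>
  have p_all: "p i = s - x i"
    if "x 4 = point_symmetry q (p 4)" and "i \<in> {1, 2, 3, 4}" for i
    using that p_eq by (auto simp: point_symmetry_def two_q)
  have part2: "x i - x j = p j - p i"
    if x4: "x 4 = point_symmetry q (p 4)" and ij: "{i, j} \<subseteq> {1, 2, 3, 4}" for i j
    using p_all[OF x4] ij by simp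
  have part3: "x i - p j = p k - x l"
    if x4: "x 4 = point_symmetry q (p 4)" and ijkl: "{i, j, k, l} = {1, 2, 3, 4}" for i j k l
  proof -
    \<comment> \<open>Four names for a set of four elements must be distinct, so the sum over the
      set has exactly one term for each name.\<close>
    have "card {i, j, k, l} = 4"
      by (simp add: ijkl)
    then have "distinct [i, j, k, l]"
      by (intro card_distinct) simp
    then have "x i + x j + x k + x l = sum x {i, j, k, l}"
      by (simp add: add.assoc)
    also have "\<dots> = x 1 + x 2 + x 3 + x 4"
      by (simp add: ijkl add.assoc)
    \<comment> \<open>The first three terms give \<open>s + p 4\<close>, and \<open>x 4\<close> is
      \<open>s - p 4\<close>.\<close>
    also have "\<dots> = s + s"
      by (simp add: x4 point_symmetry_def two_q s_def)
    finally have "x i = s + s - x j - x k - x l"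
      by (simp add: algebra_simps)
    moreover have "p j = s - x j" "p k = s - x k"
      using p_all[OF x4] ijkl by blast+
    ultimately show ?thesis
      by simp
  qed
  have part4: "homothety ((x 1 + x 2 + x 3) /\<^sub>R 3) (- 2) (p 4) = x 4"
    if "x 4 = point_symmetry q (p 4)"
    \<comment> \<open>Three times the centroid is \<open>s + p 4\<close>; subtracting
      \<open>2 *\<^sub>R p 4\<close> leaves \<open>s - p 4\<close>.\<close>
    using that unfolding homothety_minus_two
    by (simp add: point_symmetry_def two_q s_def scaleR_2[of "p 4"])
  from mid diff part2 part3 part4 show ?thesis
    by (intro exI[of _ q]) (simp add: q_def s_def)
qed

end
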